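(* Let $A$ be a unital C$^*$-algebra and let $u\in A$ be a tripotent (i.e. a partial isometry). Then: (a) $u\le 1$ iff $u$ is a projection; (b) $u\le_r 1$ iff $u$ or $-u$ is a projection; (c) $u\le_c 1$ iff $u=\alpha p$ where $p$ is a projection and $\alpha$ is a complex unit; (d) $u\le_h 1$ iff $u$ is self-adjoint; (e) $u\sim_h 1$ iff $u$ is a symmetry; (f) $u\sim_{h,t}1$ iff $u$ is a finite product of symmetries in $A$; (g) $u\le_{h,t}1$ iff there are symmetries $v_1,\dots,v_m\in A$ and a projection $p\in A$ such that $u=pv_1v_2\cdots v_m$; (h) $u\le_{hc}1$ iff $u$ is a scalar multiple of a self-adjoint element; (i) $u\sim_{hc}1$ iff $u$ is a scalar multiple of a symmetry; (j) $u\sim_{hc,t}1$ iff there are symmetries $v_1,\dots,v_m\in A$ and a complex unit $\alpha$ such that $u=\alpha v_1v_2\cdots v_m$; (k) $u\le_{hc,t}1$ iff there are symmetries $v_1,\dots,v_m\in A$, a projection $p\in A$ and a complex unit $\alpha$ such that $u=\alpha pv_1v_2\cdots v_m$; (l) $u\le_n 1$ iff $u$ is normal (i.e. $u^*u=uu^*$); (m) $u\le_{n,t}1$ iff $u=pv$ for a projection $p\in A$ and a unitary element $v\in A$; (n) $u\sim_2 1$ iff $u$ is unitary (i.e. $u^*u=uu^*=1$).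
   Context: $A$ is regarded as a JB$^*$-triple with triple product $\{a,b,c\}=\frac12(ab^*c+cb^*a)$. A tripotent is $e\in A$ with $\{e,e,e\}=e$, i.e. $ee^*e=e$ (a partial isometry). A symmetry is $v\in A$ with $v=v^*$, $v^2=1$; a projection is a self-adjoint idempotent. A complex unit is $\alpha\in\mathbb C$ with $|\alpha|=1$. Tripotents $e,u$ are orthogonal if $\{e,u,x\}=0$ for all $x\in A$. Put $A_2(e)=\{x\in A:\{e,e,x\}=x\}$. For tripotents $u,e$: - $u\le e$ iff $e-u$ is a tripotent orthogonal to $u$; - $u\le_r e$ iff $u\le e$ or $-u\le e$; - $u\le_c e$ iff $\alpha u\le e$ for some complex unit $\alpha$; - $u\le_h e$ iff $u=\{e,u,e\}$; - $u\le_{hc}e$ iff $\alpha u\le_h e$ for some complex unit $\alpha$; - $u\le_n e$ iff $u=\{e,e,u\}$ and $\{u,u,e\}$ is a tripotent; - $u\le_2 e$ iff $u\in A_2(e)$; - for $\kappa\in\{h,hc,n\}$, $\le_{\kappa,t}$ is the transitive hull of $\le_\kappa$ on the tripotents of $A$: $u\le_{\kappa,t}e$ iff there are tripotents $e=v_0,\dots,v_k=u$ in $A$ with $v_j\le_\kappa v_{j-1}$ for $j=1,\dots,k$; - for each index $\kappa$, $u\sim_\kappa e$ means $u\le_\kappa e$ and $e\le_\kappa u$ (similarly for $\sim_{\kappa,t}$).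
   Formalization: In (i) the scalar is required to be nonzero: u = 0 = 0·1 is a tripotent and a scalar multiple of a symmetry, but 0 ∼_hc 1 fails in every nonzero algebra. *)

theory Defs
  imports "HOL-Analysis.Analysis"
begin

text \<open>
  Unital C*-algebras as a type class. Combining \<^class>\<open>real_normed_algebra\<close> with
  \<^class>\<open>monoid_mult\<close> (rather than using \<^class>\<open>real_normed_algebra_1\<close>) supplies a unit
  without imposing \<open>0 \<noteq> 1\<close>, so the zero algebra is not excluded.
\<close>

class unital_cstar_algebra = real_normed_algebra + monoid_mult + banach +
  fixes scaleC :: "complex \<Rightarrow> 'a \<Rightarrow> 'a"  (infixr "*\<^sub>C" 75)
    and star :: "'a \<Rightarrow> 'a"  ("(_\<^sup>\<star>)" [1000] 999)
  assumes scaleC_add_right: "a *\<^sub>C (x + y) = a *\<^sub>C x + a *\<^sub>C y"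
    and scaleC_add_left: "(a + b) *\<^sub>C x = a *\<^sub>C x + b *\<^sub>C x"
    and scaleC_scaleC: "a *\<^sub>C b *\<^sub>C x = (a * b) *\<^sub>C x"
    and scaleC_one: "1 *\<^sub>C x = x"
    and scaleR_scaleC: "r *\<^sub>R x = complex_of_real r *\<^sub>C x"
    and mult_scaleC_left: "(a *\<^sub>C x) * y = a *\<^sub>C (x * y)"
    and mult_scaleC_right: "x * (a *\<^sub>C y) = a *\<^sub>C (x * y)"
    and norm_scaleC: "norm (a *\<^sub>C x) = cmod a * norm x"
    and star_add: "(x + y)\<^sup>\<star> = x\<^sup>\<star> + y\<^sup>\<star>"
    and star_scaleC: "(a *\<^sub>C x)\<^sup>\<star> = cnj a *\<^sub>C x\<^sup>\<star>"
    and star_mult: "(x * y)\<^sup>\<star> = y\<^sup>\<star> * x\<^sup>\<star>"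
    and star_star: "(x\<^sup>\<star>)\<^sup>\<star> = x"
    and cstar_identity: "norm (x\<^sup>\<star> * x) = (norm x)\<^sup>2"

definition triple :: "'a::unital_cstar_algebra \<Rightarrow> 'a \<Rightarrow> 'a \<Rightarrow> 'a" where
  "triple a b c = (1/2) *\<^sub>C (a * b\<^sup>\<star> * c + c * b\<^sup>\<star> * a)"

definition tripotent :: "'a::unital_cstar_algebra \<Rightarrow> bool" where
  "tripotent e \<longleftrightarrow> triple e e e = e"

definition selfadjoint :: "'a::unital_cstar_algebra \<Rightarrow> bool" where
  "selfadjoint a \<longleftrightarrow> a\<^sup>\<star> = a"

definition symmetry :: "'a::unital_cstar_algebra \<Rightarrow> bool" where
  "symmetry v \<longleftrightarrow> selfadjoint v \<and> v\<^sup>2 = 1"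

definition projection :: "'a::unital_cstar_algebra \<Rightarrow> bool" where
  "projection p \<longleftrightarrow> selfadjoint p \<and> p\<^sup>2 = p"

definition normal_element :: "'a::unital_cstar_algebra \<Rightarrow> bool" where
  "normal_element a \<longleftrightarrow> a\<^sup>\<star> * a = a * a\<^sup>\<star>"

definition unitary :: "'a::unital_cstar_algebra \<Rightarrow> bool" where
  "unitary a \<longleftrightarrow> a\<^sup>\<star> * a = 1 \<and> a * a\<^sup>\<star> = 1"

definition complex_unit :: "complex \<Rightarrow> bool" where
  "complex_unit \<alpha> \<longleftrightarrow> cmod \<alpha> = 1"

definition trip_orthogonal :: "'a::unital_cstar_algebra \<Rightarrow> 'a \<Rightarrow> bool" where
  "trip_orthogonal e u \<longleftrightarrow> (\<forall>x. triple e u x = 0)"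

definition peirce2 :: "'a::unital_cstar_algebra \<Rightarrow> 'a set" where
  "peirce2 e = {x. triple e e x = x}"

text \<open>The relations below are only meant to be applied to tripotents.\<close>

definition trip_le :: "'a::unital_cstar_algebra \<Rightarrow> 'a \<Rightarrow> bool"  (infix "\<le>\<^sub>T" 50) where
  "u \<le>\<^sub>T e \<longleftrightarrow> tripotent (e - u) \<and> trip_orthogonal (e - u) u"

definition le_r :: "'a::unital_cstar_algebra \<Rightarrow> 'a \<Rightarrow> bool" where
  "le_r u e \<longleftrightarrow> u \<le>\<^sub>T e \<or> - u \<le>\<^sub>T e"

definition le_c :: "'a::unital_cstar_algebra \<Rightarrow> 'a \<Rightarrow> bool" where
  "le_c u e \<longleftrightarrow> (\<exists>\<alpha>. complex_unit \<alpha> \<and> \<alpha> *\<^sub>C u \<le>\<^sub>T e)"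

definition le_h :: "'a::unital_cstar_algebra \<Rightarrow> 'a \<Rightarrow> bool" where
  "le_h u e \<longleftrightarrow> u = triple e u e"

definition le_hc :: "'a::unital_cstar_algebra \<Rightarrow> 'a \<Rightarrow> bool" where
  "le_hc u e \<longleftrightarrow> (\<exists>\<alpha>. complex_unit \<alpha> \<and> le_h (\<alpha> *\<^sub>C u) e)"

definition le_n :: "'a::unital_cstar_algebra \<Rightarrow> 'a \<Rightarrow> bool" where
  "le_n u e \<longleftrightarrow> u = triple e e u \<and> tripotent (triple u u e)"

definition le_2 :: "'a::unital_cstar_algebra \<Rightarrow> 'a \<Rightarrow> bool" where
  "le_2 u e \<longleftrightarrow> u \<in> peirce2 e"

definition transitive_hull ::
    "('a::unital_cstar_algebra \<Rightarrow> 'a \<Rightarrow> bool) \<Rightarrow> 'a \<Rightarrow> 'a \<Rightarrow> bool" where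
  "transitive_hull R u e \<longleftrightarrow>
     (\<exists>(k::nat) v. v 0 = e \<and> v k = u \<and> (\<forall>j\<le>k. tripotent (v j)) \<and>
                   (\<forall>j\<in>{1..k}. R (v j) (v (j - 1))))"

definition equiv_of :: "('a \<Rightarrow> 'a \<Rightarrow> bool) \<Rightarrow> 'a \<Rightarrow> 'a \<Rightarrow> bool" where
  "equiv_of R u e \<longleftrightarrow> R u e \<and> R e u"

end

theory Submission imports Defs begin

text \<open>
  Right multiplication by a unitary is an automorphism of the triple structure, so every step of a
  chain descending from \<open>p * v\<close>, with \<open>p\<close> a projection and \<open>v\<close> unitary, can be translated to a step
  \<open>w \<le> p\<close>. There \<open>w\<close> lies in the corner \<open>pAp\<close> and is selfadjoint (for \<open>\<le>\<^sub>h\<close>) or normal (for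
  \<open>\<le>\<^sub>n\<close>), and such a partial isometry factors as \<open>w = q * (w + 1 - q)\<close> with \<open>q = w * w\<^sup>\<star>\<close> a
  projection and \<open>w + 1 - q\<close> a symmetry or a unitary, respectively. The same translation builds
  the chains in the converse direction.

  Normality in the case of \<open>\<le>\<^sub>n\<close> amounts to the fact that two projections whose mean is a
  tripotent coincide.
\<close>

section \<open>Algebra in a unital C*-algebra\<close>

interpretation scaleC: module "scaleC :: complex \<Rightarrow> 'a::unital_cstar_algebra \<Rightarrow> 'a"
  by unfold_locales (simp_all add: scaleC_add_right scaleC_add_left scaleC_scaleC scaleC_one)

lemma complex_unit_cnj: "complex_unit \<alpha> \<Longrightarrow> complex_unit (cnj \<alpha>)"
  by (simp add: complex_unit_def)

lemma complex_unit_1: "complex_unit 1"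
  by (simp add: complex_unit_def)

lemma complex_unit_mult: "complex_unit \<alpha> \<Longrightarrow> complex_unit \<beta> \<Longrightarrow> complex_unit (\<alpha> * \<beta>)"
  by (simp add: complex_unit_def norm_mult)

lemma complex_unit_mult_cnj [simp]:
  assumes "complex_unit \<alpha>"
  shows "\<alpha> * cnj \<alpha> = 1" "cnj \<alpha> * \<alpha> = 1"
  using assms complex_norm_square[of \<alpha>] by (simp_all add: complex_unit_def mult.commute)

lemma scaleC_unit_cancel:
  assumes "complex_unit \<alpha>"
  shows "cnj \<alpha> *\<^sub>C \<alpha> *\<^sub>C x = (x::'a::unital_cstar_algebra)" "\<alpha> *\<^sub>C cnj \<alpha> *\<^sub>C x = x"
  using assms by simp_all

lemma star_zero [simp]: "(0::'a::unital_cstar_algebra)\<^sup>\<star> = 0"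
  using star_add[of "0::'a" 0] by simp

lemma star_uminus [simp]: "(- x)\<^sup>\<star> = - (x::'a::unital_cstar_algebra)\<^sup>\<star>"
  using star_add[of x "- x"] by (simp add: eq_neg_iff_add_eq_0 add.commute)

lemma star_diff [simp]: "(x - y)\<^sup>\<star> = x\<^sup>\<star> - (y::'a::unital_cstar_algebra)\<^sup>\<star>"
  using star_add[of x "- y"] by simp

lemma star_one [simp]: "(1::'a::unital_cstar_algebra)\<^sup>\<star> = 1"
  by (metis star_mult star_star mult_1_left mult_1_right)

declare star_add [simp] star_mult [simp] star_star [simp] star_scaleC [simp]
  mult_scaleC_left [simp] mult_scaleC_right [simp]

lemma double_eq_iff: "a + a = b + b \<longleftrightarrow> a = (b::'a::real_vector)"
  by (metis scaleR_2 scaleR_cancel_left zero_neq_numeral)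

lemma half_scaleC_double: "(1/2) *\<^sub>C (a + a) = (a::'a::unital_cstar_algebra)"
  by (simp add: scaleC_add_right scaleC_add_left[symmetric] scaleC_one)

lemma half_scaleC_eq_iff: "(1/2) *\<^sub>C a = b \<longleftrightarrow> a = b + (b::'a::unital_cstar_algebra)"
proof
  assume "(1/2) *\<^sub>C a = b"
  then have "b + b = (1/2 + 1/2) *\<^sub>C a"
    by (simp only: scaleC_add_left)
  then show "a = b + b" by (simp add: scaleC_one)
qed (simp add: half_scaleC_double)

text \<open>Clearing the factor 1/2 turns identities between triple products into ring identities
  without scalars.\<close>

lemma triple_eq_iff: "triple a b c = d \<longleftrightarrow> a * b\<^sup>\<star> * c + c * b\<^sup>\<star> * a = d + d"
  by (simp add: triple_def half_scaleC_eq_iff)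

lemma triple_same_outer: "triple a b a = a * b\<^sup>\<star> * a"
  by (simp add: triple_eq_iff)

lemma tripotent_iff: "tripotent u \<longleftrightarrow> u * u\<^sup>\<star> * u = u"
  by (simp add: tripotent_def triple_same_outer)

lemma le_h_iff: "le_h u e \<longleftrightarrow> u = e * u\<^sup>\<star> * e"
  by (simp add: le_h_def triple_same_outer)

lemma star_mult_self_eq_0: "x\<^sup>\<star> * x = 0 \<Longrightarrow> x = (0::'a::unital_cstar_algebra)"
  using cstar_identity[of x] by simp

section \<open>Projections, symmetries and unitary elements\<close>

lemma projectionD:
  assumes "projection p" shows "p\<^sup>\<star> = p" "p * p = p"
  using assms by (auto simp: projection_def selfadjoint_def power2_eq_square)

lemma symmetryD:
  assumes "symmetry v" shows "v\<^sup>\<star> = v" "v * v = 1"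
  using assms by (auto simp: symmetry_def selfadjoint_def power2_eq_square)

lemma projectionI: "p\<^sup>\<star> = p \<Longrightarrow> p * p = p \<Longrightarrow> projection p"
  by (auto simp: projection_def selfadjoint_def power2_eq_square)

lemma symmetryI: "v\<^sup>\<star> = v \<Longrightarrow> v * v = 1 \<Longrightarrow> symmetry v"
  by (auto simp: symmetry_def selfadjoint_def power2_eq_square)

lemma projection_1: "projection 1"
  by (simp add: projectionI)

lemma unitaryD:
  assumes "unitary v" shows "v\<^sup>\<star> * v = 1" "v * v\<^sup>\<star> = 1"
  using assms by (auto simp: unitary_def)

lemma unitary_cancel:
  assumes "unitary v"
  shows "x * v * v\<^sup>\<star> = x" "x * v\<^sup>\<star> * v = x" "v * (v\<^sup>\<star> * x) = x" "v\<^sup>\<star> * (v * x) = x"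
  using unitaryD[OF assms] by (simp_all add: mult.assoc) (simp_all flip: mult.assoc)

lemma tripotent_1: "tripotent 1"
  by (simp add: tripotent_iff)

lemma projection_imp_tripotent: "projection p \<Longrightarrow> tripotent p"
  by (simp add: tripotent_iff projectionD)

lemma unitary_imp_tripotent: "unitary v \<Longrightarrow> tripotent v"
  by (simp add: tripotent_iff unitaryD)

lemma symmetry_imp_unitary: "symmetry v \<Longrightarrow> unitary v"
  by (simp add: unitary_def symmetryD)

lemma unitary_1: "unitary 1"
  by (simp add: unitary_def)

lemma unitary_star: "unitary v \<Longrightarrow> unitary (v\<^sup>\<star>)"
  by (simp add: unitary_def)

lemma unitary_mult:
  assumes "unitary v" "unitary w" shows "unitary (v * w)"
  using assms by (simp add: unitary_def mult.assoc unitary_cancel)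

lemma unitary_scaleC:
  assumes "complex_unit \<alpha>" "unitary v" shows "unitary (\<alpha> *\<^sub>C v)"
  using assms by (simp add: unitary_def)

lemma unitary_prod_list: "\<forall>v\<in>set vs. unitary v \<Longrightarrow> unitary (prod_list vs)"
  by (induction vs) (auto simp: unitary_1 unitary_mult)

section \<open>Invariance under complex units and under right translation by unitaries\<close>

lemma tripotent_scaleC:
  assumes "complex_unit \<alpha>" "tripotent u" shows "tripotent (\<alpha> *\<^sub>C u)"
  using assms by (simp add: tripotent_iff)

text \<open>The starred middle factor makes each inner \<open>v * v\<^sup>\<star>\<close> cancel, so
  only the outermost \<open>v\<close> survives.\<close>

lemma triple_mult_unitary:
  assumes "unitary v"
  shows "triple (a * v) (b * v) (c * v) = triple a b c * v"
proof -
  have "(a * v) * (b * v)\<^sup>\<star> * (c * v) = a * b\<^sup>\<star> * c * v" for a b c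
    by (simp add: mult.assoc unitary_cancel[OF assms])
  then show ?thesis by (simp add: triple_def distrib_right)
qed

lemma tripotent_mult_unitary:
  assumes "unitary v" "tripotent u" shows "tripotent (u * v)"
  using assms by (simp add: tripotent_def triple_mult_unitary)

lemma le_h_mult_unitary:
  assumes "unitary v" "le_h u e" shows "le_h (u * v) (e * v)"
  using assms by (simp add: le_h_def triple_mult_unitary)

lemma le_n_mult_unitary:
  assumes "unitary v" "le_n u e" shows "le_n (u * v) (e * v)"
  using assms by (simp add: le_n_def triple_mult_unitary tripotent_mult_unitary)

lemma le_h_scaleC:
  assumes "complex_unit \<alpha>" "le_h u e" shows "le_h (\<alpha> *\<^sub>C u) (\<alpha> *\<^sub>C e)"
  using assms by (simp add: le_h_iff)

lemma prod_list_symmetry_unitary: "\<forall>v\<in>set vs. symmetry v \<Longrightarrow> unitary (prod_list vs)"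
  by (simp add: symmetry_imp_unitary unitary_prod_list)


section \<open>Mean of two projections\<close>

lemma projection_star_mult: "tripotent u \<Longrightarrow> projection (u\<^sup>\<star> * u)"
  by (rule projectionI) (simp_all add: tripotent_iff mult.assoc)

lemma projection_mult_star: "tripotent u \<Longrightarrow> projection (u * u\<^sup>\<star>)"
  by (rule projectionI) (simp_all add: tripotent_iff flip: mult.assoc)

lemma norm_projection_le_1:
  assumes "projection (p::'a::unital_cstar_algebra)" shows "norm p \<le> 1"
proof (rule ccontr)
  assume "\<not> norm p \<le> 1"
  moreover have "norm p * norm p = norm p"
    using cstar_identity[of p] by (simp add: projectionD[OF assms] power2_eq_square)
  ultimately show False by simp
qed

text \<open>
  The elementary norm estimate replaces an appeal to positivity: from \<open>(p + q) * k = - (k + k)\<close>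
  one gets \<open>3 * p * k = - p * q * k\<close> and hence \<open>3 * norm (p * k) \<le> norm (q * k)\<close>, and symmetrically.
\<close>
lemma projection_sum_eigenvector_eq_0:
  fixes p q k :: "'a::unital_cstar_algebra"
  assumes p: "projection p" and q: "projection q" and k: "p * k + q * k = - (k + k)"
  shows "k = 0"
proof -
  have est: "3 * norm (p * k) \<le> norm (q * k)"
    if p: "projection p" and k: "p * k + q * k = - (k + k)" for p q :: 'a
  proof -
    have "p * (p * k + q * k) = p * (- (k + k))" by (simp only: k)
    then have "p * k + p * (q * k) = - (p * k + p * k)"
      by (simp add: distrib_left right_diff_distrib projectionD[OF p] flip: mult.assoc)
    then have "p * (q * k) = - (p * k + p * k + p * k)"
      by (simp add: algebra_simps)
    also have "\<dots> = - (3 *\<^sub>R (p * k))"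
      using scaleR_add_left[of 2 1 "p * k"] by (simp add: scaleR_2)
    finally have "3 * norm (p * k) = norm (p * (q * k))" by simp
    also have "\<dots> \<le> norm p * norm (q * k)" by (rule norm_mult_ineq)
    also have "\<dots> \<le> norm (q * k)"
      using mult_right_mono[OF norm_projection_le_1[OF p], of "norm (q * k)"] by simp
    finally show ?thesis .
  qed
  have "3 * norm (p * k) \<le> norm (q * k)" using est p k .
  moreover have "3 * norm (q * k) \<le> norm (p * k)"
    using est q k by (simp add: add.commute)
  \<comment> \<open>Chaining the two estimates gives
    \<open>9 * norm (p * k) \<le> norm (p * k)\<close>.\<close>
  ultimately have "norm (p * k) = 0" "norm (q * k) = 0"
    using norm_ge_zero[of "p * k"] norm_ge_zero[of "q * k"] by linarith+
  then have "k + k = 0 + 0" using k by (metis add_0 minus_equation_iff norm_eq_zero minus_zero)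
  then show ?thesis by (simp only: double_eq_iff)
qed

text \<open>The mean \<open>h\<close> is selfadjoint with \<open>h * h * h = h\<close>, so
  \<open>k = h - h * h\<close> satisfies \<open>h * k = - k\<close>. A sum of two projections has no
  eigenvalue -2, hence \<open>k = 0\<close> and \<open>h\<close> is idempotent.\<close>

lemma projections_eq_if_mean_tripotent:
  fixes p q :: "'a::unital_cstar_algebra"
  assumes p: "projection p" and q: "projection q" and h: "tripotent ((1/2) *\<^sub>C (p + q))"
  shows "p = q"
proof -
  define h where "h = (1/2) *\<^sub>C (p + q)"
  define k where "k = h - h * h"
  have hh: "p + q = h + h" using half_scaleC_eq_iff[of "p + q" h] h_def by simp
  have "h\<^sup>\<star> = h" by (simp add: h_def projectionD p q)
  then have h3: "h * h * h = h" using h by (simp add: tripotent_iff flip: h_def)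
  then have "h * k = - k" by (simp add: k_def algebra_simps flip: mult.assoc)
  then have "(p + q) * k = - (k + k)" unfolding hh by (simp add: distrib_right)
  then have "k = 0"
    using projection_sum_eigenvector_eq_0[OF p q, of k] by (simp add: distrib_right)
  then have "(p + q) * (p + q) = (p + q) + (p + q)"
    unfolding hh by (simp add: k_def algebra_simps)
  \<comment> \<open>The squares of \<open>p + q\<close> and \<open>p - q\<close> add up to twice
    \<open>p + q\<close>, which is already the square of \<open>p + q\<close>.\<close>
  then have "(p - q)\<^sup>\<star> * (p - q) = 0"
    by (simp add: projectionD p q algebra_simps)
  then show ?thesis using star_mult_self_eq_0[of "p - q"] by simp
qed

lemma normal_if_mean_tripotent:
  assumes "tripotent u" "tripotent ((1/2) *\<^sub>C (u * u\<^sup>\<star> + u\<^sup>\<star> * u))"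
  shows "normal_element u"
  using projections_eq_if_mean_tripotent[OF projection_mult_star projection_star_mult] assms
  by (metis normal_element_def)


section \<open>Single steps below the unit and below a projection\<close>

text \<open>Testing orthogonality at \<open>1\<close> alone suffices: it expresses twice
  \<open>u\<^sup>\<star>\<close> as a selfadjoint element, so \<open>u\<close> is selfadjoint, and
  the same equation then says that \<open>u\<close> is idempotent.\<close>

lemma trip_le_1_iff: "u \<le>\<^sub>T 1 \<longleftrightarrow> projection u"
proof
  assume "u \<le>\<^sub>T 1"
  then have "triple (1 - u) u 1 = 0" by (simp add: trip_le_def trip_orthogonal_def)
  then have *: "u\<^sup>\<star> + u\<^sup>\<star> = u * u\<^sup>\<star> + u\<^sup>\<star> * u"
    by (simp add: triple_eq_iff algebra_simps)
  then have "(u\<^sup>\<star> + u\<^sup>\<star>)\<^sup>\<star> = u\<^sup>\<star> + u\<^sup>\<star>" by simp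
  then have sa: "u\<^sup>\<star> = u" by (simp add: double_eq_iff)
  with * have "u + u = u * u + u * u" by simp
  then have "u * u = u" by (simp add: double_eq_iff)
  with sa show "projection u" by (rule projectionI)
next
  assume "projection u"
  note u = projectionD[OF this]
  show "u \<le>\<^sub>T 1"
    by (simp add: trip_le_def trip_orthogonal_def tripotent_iff triple_eq_iff u left_diff_distrib
        right_diff_distrib mult.assoc)
qed

lemma le_h_1_iff: "le_h u 1 \<longleftrightarrow> selfadjoint u"
  by (auto simp: le_h_iff selfadjoint_def)

text \<open>Here \<open>triple u u 1\<close> is the mean of the projections
  \<open>u * u\<^sup>\<star>\<close> and \<open>u\<^sup>\<star> * u\<close>; if \<open>u\<close> is
  normal, it is their common value.\<close>

lemma le_n_1_iff:
  assumes "tripotent u" shows "le_n u 1 \<longleftrightarrow> normal_element u"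
proof
  assume "le_n u 1"
  then show "normal_element u"
    using normal_if_mean_tripotent[OF assms] by (simp add: le_n_def triple_def)
next
  assume "normal_element u"
  then have "triple u u 1 = u\<^sup>\<star> * u" by (simp add: triple_eq_iff normal_element_def)
  moreover have "u = triple 1 1 u" by (simp add: triple_def half_scaleC_double)
  ultimately show "le_n u 1"
    using projection_imp_tripotent[OF projection_star_mult[OF assms]] by (simp add: le_n_def)
qed

lemma equiv_le_2_1_iff:
  assumes "tripotent u" shows "equiv_of le_2 u 1 \<longleftrightarrow> unitary u"
proof
  assume "equiv_of le_2 u 1"
  then have "triple u u 1 = 1" by (simp add: equiv_of_def le_2_def peirce2_def)
  then have s: "u * u\<^sup>\<star> + u\<^sup>\<star> * u = 1 + 1" by (simp add: triple_eq_iff)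
  define p q where "p = u * u\<^sup>\<star>" and "q = u\<^sup>\<star> * u"
  have p: "p * p = p" and q: "q * q = q"
    using projectionD(2)[OF projection_mult_star[OF assms]]
      projectionD(2)[OF projection_star_mult[OF assms]] by (simp_all only: p_def q_def)
  \<comment> \<open>Multiplying \<open>p + q = 1 + 1\<close> by \<open>p\<close> on the left and by
    \<open>q\<close> on the right identifies \<open>p * q\<close> with both \<open>p\<close> and
    \<open>q\<close>.\<close>
  have "p * (p + q) = p * (1 + 1)" "(p + q) * q = (1 + 1) * q"
    using s by (simp_all add: p_def q_def)
  then have "p * q = p" "p * q = q" by (simp_all add: distrib_left distrib_right p q)
  then have "p = q" by simp
  with s have "p + p = 1 + 1" by (simp add: p_def q_def)
  then have "p = 1" by (simp only: double_eq_iff)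
  with \<open>p = q\<close> show "unitary u" by (simp add: p_def q_def unitary_def)
next
  assume "unitary u"
  then show "equiv_of le_2 u 1"
    by (simp add: equiv_of_def le_2_def peirce2_def triple_eq_iff unitaryD)
qed

text \<open>Normality makes the initial and final projections of \<open>w\<close> coincide in
  \<open>q\<close>, so \<open>w\<close> is a unitary of the corner cut out by \<open>q\<close>.
  Adding the complementary \<open>1 - q\<close> extends it to a unitary of the whole algebra, and
  multiplying by \<open>q\<close> removes that summand again.\<close>

lemma tripotent_normal_factor:
  assumes w: "tripotent w" and n: "normal_element w"
  defines "q \<equiv> w * w\<^sup>\<star>"
  shows "projection q" "unitary (w + 1 - q)" "w = q * (w + 1 - q)"
proof -
  have q: "q = w\<^sup>\<star> * w" using n by (simp add: q_def normal_element_def)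
  show pq: "projection q" unfolding q_def by (rule projection_mult_star[OF w])
  note pq = projectionD[OF this]
  have qw: "q * w = w" using w by (simp add: q_def tripotent_iff)
  have wq: "w * q = w" using w by (simp add: q tripotent_iff mult.assoc)
  have qw': "q * w\<^sup>\<star> = w\<^sup>\<star>" "w\<^sup>\<star> * q = w\<^sup>\<star>"
    using arg_cong[OF wq, of star] arg_cong[OF qw, of star] by (simp_all add: pq)
  note r = pq qw wq qw' q_def[symmetric] q[symmetric]
  show "unitary (w + 1 - q)"
    by (simp add: unitary_def algebra_simps r)
  show "w = q * (w + 1 - q)"
    by (simp add: algebra_simps r)
qed

text \<open>The unitary factor \<open>w + 1 - q\<close> inherits selfadjointness from
  \<open>w\<close>, and a selfadjoint unitary is a symmetry.\<close>

lemma tripotent_selfadjoint_factor: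
  assumes w: "tripotent w" and sa: "selfadjoint w"
  shows "\<exists>q v. projection q \<and> symmetry v \<and> w = q * v"
proof -
  have s: "w\<^sup>\<star> = w" using sa by (simp add: selfadjoint_def)
  then have n: "normal_element w" by (simp add: normal_element_def)
  note f = tripotent_normal_factor[OF w n]
  have "(w + 1 - w * w\<^sup>\<star>)\<^sup>\<star> = w + 1 - w * w\<^sup>\<star>" by (simp add: s)
  then have "symmetry (w + 1 - w * w\<^sup>\<star>)"
    using unitaryD(1)[OF f(2)] by (intro symmetryI) simp_all
  with f show ?thesis by blast
qed

text \<open>The equation \<open>w = p * w\<^sup>\<star> * p\<close> puts \<open>w\<close> into the
  corner of \<open>p\<close>, so \<open>p * w * p = w\<close>, while its adjoint reads
  \<open>w\<^sup>\<star> = p * w * p\<close>.\<close>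

lemma le_h_projection_imp_selfadjoint:
  assumes p: "projection p" and "le_h w p" shows "selfadjoint w"
proof -
  note p = projectionD[OF p]
  have w: "w = p * w\<^sup>\<star> * p" using assms by (simp add: le_h_iff)
  have "p * w * p = p * p * w\<^sup>\<star> * (p * p)" by (subst w) (simp only: mult.assoc)
  with w have "p * w * p = w" by (simp add: p)
  moreover have "w\<^sup>\<star> = p * w * p" by (subst w) (simp add: p mult.assoc)
  ultimately show ?thesis by (simp add: selfadjoint_def)
qed

text \<open>Multiplying \<open>p * w + w * p = w + w\<close> by \<open>p\<close> from either side
  shows that \<open>p\<close> acts as a unit on \<open>w\<close>. The argument below
  \<open>1\<close> then applies inside the corner of \<open>p\<close>.\<close>

lemma le_n_projection_imp_normal:
  assumes p: "projection p" and w: "tripotent w" and le: "le_n w p" shows "normal_element w"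
proof -
  note p = projectionD[OF p]
  have "triple p p w = w" using le by (simp add: le_n_def)
  then have s: "p * w + w * p = w + w" by (simp add: triple_eq_iff p mult.assoc)
  have "p * (p * w + w * p) = p * (w + w)" "(p * w + w * p) * p = (w + w) * p"
    by (simp_all only: s)
  then have "p * w * p = p * w" "p * w * p = w * p"
    by (simp_all add: distrib_left distrib_right p mult.assoc) (simp_all add: p flip: mult.assoc)
  then have "p * w = w * p" by simp
  with s have wp: "w * p = w" and pw: "p * w = w" by (simp_all add: double_eq_iff)
  have "p * w\<^sup>\<star> = w\<^sup>\<star>" "w\<^sup>\<star> * p = w\<^sup>\<star>"
    using arg_cong[OF wp, of star] arg_cong[OF pw, of star] by (simp_all add: p)
  then have "triple w w p = (1/2) *\<^sub>C (w * w\<^sup>\<star> + w\<^sup>\<star> * w)"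
    by (simp add: triple_def mult.assoc)
  then show ?thesis using normal_if_mean_tripotent[OF w] le by (simp add: le_n_def)
qed

text \<open>Unitarity passes upwards: \<open>u = e * u\<^sup>\<star> * e\<close> is fixed by
  \<open>e * e\<^sup>\<star>\<close> on the left and by \<open>e\<^sup>\<star> * e\<close> on the
  right, and the unitary \<open>u\<close> cancels from both equations.\<close>

lemma unitary_if_le_h_unitary:
  assumes u: "unitary u" and e: "tripotent e" and le: "le_h u e" shows "unitary e"
proof -
  have ue: "u = e * u\<^sup>\<star> * e" using le by (simp add: le_h_iff)
  have "e * e\<^sup>\<star> * u = (e * e\<^sup>\<star> * e) * u\<^sup>\<star> * e" by (subst ue) (simp add: mult.assoc)
  then have "e * e\<^sup>\<star> * u = u" using e ue by (simp add: tripotent_iff)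
  then have "e * e\<^sup>\<star> * u * u\<^sup>\<star> = u * u\<^sup>\<star>" by simp
  then have 1: "e * e\<^sup>\<star> = 1" by (simp add: unitary_cancel unitaryD u)
  have "u * (e\<^sup>\<star> * e) = e * u\<^sup>\<star> * (e * e\<^sup>\<star> * e)" by (subst ue) (simp add: mult.assoc)
  then have "u * (e\<^sup>\<star> * e) = u" using e ue by (simp add: tripotent_iff)
  then have "u\<^sup>\<star> * (u * (e\<^sup>\<star> * e)) = u\<^sup>\<star> * u" by simp
  then have 2: "e\<^sup>\<star> * e = 1" by (simp add: unitary_cancel unitaryD u)
  from 1 2 show ?thesis by (simp add: unitary_def)
qed


section \<open>Transitive hulls\<close>

lemma transitive_hull_refl: "tripotent e \<Longrightarrow> transitive_hull R e e"
  unfolding transitive_hull_def by (rule exI[of _ 0], rule exI[of _ "\<lambda>_. e"]) simp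

lemma transitive_hull_step:
  assumes "transitive_hull R w e" "tripotent u" "R u w"
  shows "transitive_hull R u e"
proof -
  obtain k :: nat and v where v: "v 0 = e" "v k = w" "\<forall>j\<le>k. tripotent (v j)"
    "\<forall>j\<in>{1..k}. R (v j) (v (j - 1))"
    using assms(1) unfolding transitive_hull_def by blast
  show ?thesis unfolding transitive_hull_def
    by (rule exI[of _ "Suc k"], rule exI[of _ "v(Suc k := u)"])
      (use v assms(2,3) in \<open>auto simp: le_Suc_eq\<close>)
qed

lemma transitive_hull_tripotent:
  assumes "transitive_hull R u e" shows "tripotent u" "tripotent e"
  using assms unfolding transitive_hull_def by auto

text \<open>Chains are indexed downwards from \<open>e\<close>, so the induction starts at the upper
  end and passes from the larger \<open>w\<close> to the smaller \<open>u\<close>.\<close>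

lemma transitive_hull_induct [consumes 1, case_names refl step]:
  assumes "transitive_hull R u e" and "P e"
    and "\<And>w u. tripotent w \<Longrightarrow> tripotent u \<Longrightarrow> R u w \<Longrightarrow> P w \<Longrightarrow> P u"
  shows "P u"
proof -
  obtain k :: nat and v where v: "v 0 = e" "v k = u" "\<forall>j\<le>k. tripotent (v j)"
    "\<forall>j\<in>{1..k}. R (v j) (v (j - 1))"
    using assms(1) unfolding transitive_hull_def by blast
  have "j \<le> k \<Longrightarrow> P (v j)" for j
  proof (induction j)
    case 0
    then show ?case using v assms(2) by simp
  next
    case (Suc j)
    then have "R (v (Suc j)) (v j)" using v(4)[rule_format, of "Suc j"] by simp
    moreover have "tripotent (v j)" "tripotent (v (Suc j))" using v(3) Suc.prems by simp_all
    ultimately show ?case using Suc assms(3)[of "v j" "v (Suc j)"] by simp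
  qed
  with v(2) show ?thesis by blast
qed

lemma transitive_hull_trans:
  assumes "transitive_hull R u w" "transitive_hull R w e" shows "transitive_hull R u e"
  using assms by (induction rule: transitive_hull_induct) (auto intro: transitive_hull_step)

text \<open>Serves both to enlarge the relation (with \<open>f\<close> the identity) and to multiply
  a chain by a complex unit.\<close>

lemma transitive_hull_map:
  assumes "transitive_hull R u e"
    and "\<And>x. tripotent x \<Longrightarrow> tripotent (f x)"
    and "\<And>x y. tripotent x \<Longrightarrow> tripotent y \<Longrightarrow> R x y \<Longrightarrow> S (f x) (f y)"
  shows "transitive_hull S (f u) (f e)"
proof -
  have "tripotent e" using transitive_hull_tripotent[OF assms(1)] by simp
  with assms(1) show ?thesis
    by (induction rule: transitive_hull_induct)
      (auto intro: transitive_hull_refl transitive_hull_step assms(2,3))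
qed

lemma transitive_hull_mono:
  assumes "transitive_hull R u e" "\<And>x y. R x y \<Longrightarrow> S x y"
  shows "transitive_hull S u e"
  using transitive_hull_map[OF assms(1), of id S] assms(2) by simp

lemma transitive_hull_single:
  "tripotent u \<Longrightarrow> tripotent e \<Longrightarrow> R u e \<Longrightarrow> transitive_hull R u e"
  by (rule transitive_hull_step[OF transitive_hull_refl])

section \<open>Collecting the scalars of a chain\<close>

lemma transitive_hull_le_h_scaleC:
  assumes "complex_unit \<alpha>" "transitive_hull le_h u e"
  shows "transitive_hull le_h (\<alpha> *\<^sub>C u) (\<alpha> *\<^sub>C e)"
  using transitive_hull_map[OF assms(2), of "scaleC \<alpha>" le_h] assms(1)
  by (simp add: tripotent_scaleC le_h_scaleC)

text \<open>Since \<open>le_h\<close> is invariant under scaling both sides by one complex unit, the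
  scalars of the single steps accumulate into one scalar on the lower end.\<close>

lemma transitive_hull_le_hc_iff:
  assumes "tripotent u"
  shows "transitive_hull le_hc u e \<longleftrightarrow>
    (\<exists>\<alpha>. complex_unit \<alpha> \<and> transitive_hull le_h (\<alpha> *\<^sub>C u) e)"
proof
  assume "transitive_hull le_hc u e"
  moreover from this have "tripotent e" by (rule transitive_hull_tripotent)
  ultimately show "\<exists>\<alpha>. complex_unit \<alpha> \<and> transitive_hull le_h (\<alpha> *\<^sub>C u) e"
  proof (induction rule: transitive_hull_induct)
    case refl
    then show ?case
      by (intro exI[of _ 1]) (simp add: complex_unit_1 scaleC_one transitive_hull_refl)
  next
    case (step w u)
    then obtain \<alpha> \<beta> where \<alpha>: "complex_unit \<alpha>" "transitive_hull le_h (\<alpha> *\<^sub>C w) e"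
      and \<beta>: "complex_unit \<beta>" "le_h (\<beta> *\<^sub>C u) w"
      by (auto simp: le_hc_def)
    \<comment> \<open>Scaling the new step by \<alpha> attaches it to the end of the chain built so
      far.\<close>
    have "le_h ((\<alpha> * \<beta>) *\<^sub>C u) (\<alpha> *\<^sub>C w)"
      using le_h_scaleC[OF \<alpha>(1) \<beta>(2)] by (simp add: scaleC_scaleC)
    with \<alpha> \<beta>(1) step.hyps show ?case
      by (blast intro: transitive_hull_step tripotent_scaleC complex_unit_mult)
  qed
next
  assume "\<exists>\<alpha>. complex_unit \<alpha> \<and> transitive_hull le_h (\<alpha> *\<^sub>C u) e"
  then obtain \<alpha> where \<alpha>: "complex_unit \<alpha>" "transitive_hull le_h (\<alpha> *\<^sub>C u) e" by blast
  have "le_hc x y" if "le_h x y" for x y :: 'a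
    using that complex_unit_1 by (auto simp: le_hc_def scaleC_one intro!: exI[of _ 1])
  with \<alpha>(2) have hull: "transitive_hull le_hc (\<alpha> *\<^sub>C u) e" by (rule transitive_hull_mono)
  \<comment> \<open>\<open>le_h\<close> is reflexive on tripotents, so one last \<open>le_hc\<close>
    step leads from the scaled element down to \<open>u\<close>.\<close>
  have "le_h (\<alpha> *\<^sub>C u) (\<alpha> *\<^sub>C u)"
    using tripotent_scaleC[OF \<alpha>(1) assms] unfolding le_h_iff tripotent_iff by simp
  with \<alpha>(1) have "le_hc u (\<alpha> *\<^sub>C u)" by (auto simp: le_hc_def)
  then show "transitive_hull le_hc u e" using transitive_hull_step[OF hull assms] by blast
qed

text \<open>A symmetry and \<open>1\<close> lie below each other for \<open>le_h\<close>.
  Translating these two steps by the product of the remaining factors adds or removes the first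
  factor.\<close>

lemma transitive_hull_le_h_prod_list:
  assumes "\<forall>v\<in>set vs. symmetry v"
  shows "transitive_hull le_h (prod_list vs) 1" "transitive_hull le_h 1 (prod_list vs)"
  using assms
proof (induction vs)
  case Nil
  {
    case 1 show ?case by (simp add: transitive_hull_refl tripotent_1)
  next
    case 2 show ?case by (simp add: transitive_hull_refl tripotent_1)
  }
next
  case (Cons v vs)
  have s: "unitary (prod_list vs)" if "\<forall>v\<in>set (v # vs). symmetry v"
    using that by (simp add: prod_list_symmetry_unitary)
  have t: "tripotent (v * prod_list vs)" "tripotent (prod_list vs)"
    if "\<forall>v\<in>set (v # vs). symmetry v"
    using s[OF that] that by (simp_all add: unitary_imp_tripotent unitary_mult symmetry_imp_unitary)
  {
    case 1
    then have "le_h v 1" by (simp add: le_h_iff symmetryD)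
    then have "le_h (v * prod_list vs) (prod_list vs)"
      using le_h_mult_unitary[OF s] 1 by fastforce
    moreover have "transitive_hull le_h (prod_list vs) 1" using Cons 1 by simp
    ultimately show ?case using t(1)[OF 1] transitive_hull_step by simp
  next
    case 2
    then have "le_h 1 v" by (simp add: le_h_iff symmetryD)
    then have "le_h (prod_list vs) (v * prod_list vs)"
      using le_h_mult_unitary[OF s] 2 by fastforce
    with t[OF 2] have "transitive_hull le_h (prod_list vs) (v * prod_list vs)"
      by (simp add: transitive_hull_single)
    moreover have "transitive_hull le_h 1 (prod_list vs)" using Cons 2 by simp
    ultimately show ?case using transitive_hull_trans by simp
  }
qed

text \<open>Going down a chain, each step replaces the projection by a new one and puts one more
  symmetry in front of the list. Conversely, \<open>p\<close> lies below \<open>1\<close>, so its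
  translate \<open>u\<close> lies one step below the product of symmetries.\<close>

lemma transitive_hull_le_h_1_iff:
  "transitive_hull le_h u 1 \<longleftrightarrow>
    (\<exists>p vs. projection p \<and> (\<forall>v\<in>set vs. symmetry v) \<and> u = p * prod_list vs)"
proof
  assume "transitive_hull le_h u 1"
  then show "\<exists>p vs. projection p \<and> (\<forall>v\<in>set vs. symmetry v) \<and> u = p * prod_list vs"
  proof (induction rule: transitive_hull_induct)
    case refl
    show ?case by (intro exI[of _ 1] exI[of _ "[]"]) (simp add: projection_1)
  next
    case (step e u)
    then obtain p vs where p: "projection p" and vs: "\<forall>v\<in>set vs. symmetry v"
      and e: "e = p * prod_list vs" by blast
    define s where "s = prod_list vs"
    have s: "unitary s" using vs by (simp add: s_def prod_list_symmetry_unitary)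
    have "le_h (u * s\<^sup>\<star>) (p * s * s\<^sup>\<star>)"
      using le_h_mult_unitary[OF unitary_star[OF s] step.hyps(3)] by (simp add: e s_def)
    then have "selfadjoint (u * s\<^sup>\<star>)"
      using le_h_projection_imp_selfadjoint[OF p] by (simp only: unitary_cancel[OF s])
    then obtain q v where q: "projection q" "symmetry v" "u * s\<^sup>\<star> = q * v"
      using tripotent_selfadjoint_factor tripotent_mult_unitary[OF unitary_star[OF s] step.hyps(2)]
      by blast
    have "u = u * s\<^sup>\<star> * s" by (simp only: unitary_cancel[OF s])
    then have "u = q * v * s" by (simp only: q)
    then have "u = q * prod_list (v # vs)" by (simp add: s_def mult.assoc)
    with q vs show ?case by (intro exI[of _ q] exI[of _ "v # vs"]) simp
  qed
next
  assume "\<exists>p vs. projection p \<and> (\<forall>v\<in>set vs. symmetry v) \<and> u = p * prod_list vs"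
  then obtain p vs where p: "projection p" and vs: "\<forall>v\<in>set vs. symmetry v"
    and u: "u = p * prod_list vs" by blast
  have s: "unitary (prod_list vs)" using vs by (rule prod_list_symmetry_unitary)
  have "le_h p 1" using p by (simp add: le_h_iff projectionD)
  then have "le_h u (prod_list vs)" using le_h_mult_unitary[OF s] u by fastforce
  moreover have "tripotent u"
    using tripotent_mult_unitary[OF s projection_imp_tripotent[OF p]] u by simp
  ultimately show "transitive_hull le_h u 1"
    using transitive_hull_le_h_prod_list(1)[OF vs] by (blast intro: transitive_hull_step)
qed

lemma unitary_if_transitive_hull_le_h:
  assumes "transitive_hull le_h u e" "unitary u" shows "unitary e"
  using assms by (induction rule: transitive_hull_induct) (auto intro: unitary_if_le_h_unitary)

lemma projection_eq_1_if_unitary: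
  assumes p: "projection p" and s: "unitary s" and "unitary (p * s)" shows "p = 1"
proof -
  have "p * s * (p * s)\<^sup>\<star> = 1" using assms(3) by (rule unitaryD)
  moreover have "p * s * (p * s)\<^sup>\<star> = p * (s * (s\<^sup>\<star> * p))"
    by (simp add: projectionD[OF p] mult.assoc)
  ultimately show ?thesis by (simp add: unitary_cancel[OF s] projectionD[OF p])
qed

lemma transitive_hull_le_h_1_unitary:
  assumes "transitive_hull le_h u 1" "unitary u"
  shows "\<exists>vs. (\<forall>v\<in>set vs. symmetry v) \<and> u = prod_list vs"
proof -
  obtain p vs where p: "projection p" and vs: "\<forall>v\<in>set vs. symmetry v"
    and u: "u = p * prod_list vs" using assms(1) transitive_hull_le_h_1_iff by blast
  have "p = 1"
    using projection_eq_1_if_unitary[OF p prod_list_symmetry_unitary[OF vs]] assms(2) u by simp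
  with vs u show ?thesis by auto
qed

text \<open>A chain from \<open>u\<close> down to the unitary \<open>1\<close> makes
  \<open>u\<close> unitary, and this forces the projection in the factorization of \<open>u\<close>
  to be \<open>1\<close>.\<close>

lemma equiv_hull_le_h_1_iff:
  "equiv_of (transitive_hull le_h) u 1 \<longleftrightarrow>
    (\<exists>vs. (\<forall>v\<in>set vs. symmetry v) \<and> u = prod_list vs)"
proof
  assume "equiv_of (transitive_hull le_h) u 1"
  then have "transitive_hull le_h u 1" "transitive_hull le_h 1 u" by (simp_all add: equiv_of_def)
  then show "\<exists>vs. (\<forall>v\<in>set vs. symmetry v) \<and> u = prod_list vs"
    using transitive_hull_le_h_1_unitary unitary_if_transitive_hull_le_h unitary_1 by blast
qed (auto simp: equiv_of_def transitive_hull_le_h_prod_list)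

lemma transitive_hull_le_hc_1_iff:
  assumes "tripotent u"
  shows "transitive_hull le_hc u 1 \<longleftrightarrow>
    (\<exists>\<alpha> p vs. complex_unit \<alpha> \<and> projection p \<and> (\<forall>v\<in>set vs. symmetry v) \<and>
      u = \<alpha> *\<^sub>C (p * prod_list vs))"
    (is "_ \<longleftrightarrow> ?R")
proof -
  have "?R \<longleftrightarrow> (\<exists>\<alpha>. complex_unit \<alpha> \<and> transitive_hull le_h (\<alpha> *\<^sub>C u) 1)"
    unfolding transitive_hull_le_h_1_iff
    by (metis complex_unit_cnj scaleC_unit_cancel)
  then show ?thesis using transitive_hull_le_hc_iff[OF assms] by blast
qed

lemma equiv_hull_le_hc_1_iff:
  assumes "tripotent u"
  shows "equiv_of (transitive_hull le_hc) u 1 \<longleftrightarrow>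
    (\<exists>\<alpha> vs. complex_unit \<alpha> \<and> (\<forall>v\<in>set vs. symmetry v) \<and> u = \<alpha> *\<^sub>C prod_list vs)"
proof
  assume "equiv_of (transitive_hull le_hc) u 1"
  then obtain \<alpha> \<beta> where \<alpha>: "complex_unit \<alpha>" "transitive_hull le_h (\<alpha> *\<^sub>C u) 1"
    and \<beta>: "complex_unit \<beta>" "transitive_hull le_h (\<beta> *\<^sub>C 1) u"
    unfolding equiv_of_def transitive_hull_le_hc_iff[OF assms]
      transitive_hull_le_hc_iff[OF tripotent_1] by blast
  \<comment> \<open>The chain from \<open>u\<close> ends in a unitary multiple of \<open>1\<close>,
    and unitarity passes upwards.\<close>
  have "unitary u"
    by (rule unitary_if_transitive_hull_le_h[OF \<beta>(2) unitary_scaleC[OF \<beta>(1) unitary_1]])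
  then have "unitary (\<alpha> *\<^sub>C u)" by (rule unitary_scaleC[OF \<alpha>(1)])
  then obtain vs where vs: "\<forall>v\<in>set vs. symmetry v" "\<alpha> *\<^sub>C u = prod_list vs"
    using transitive_hull_le_h_1_unitary[OF \<alpha>(2)] by blast
  then have "u = cnj \<alpha> *\<^sub>C prod_list vs" using \<alpha>(1) by (simp flip: vs(2))
  with vs \<alpha> show "\<exists>\<alpha> vs. complex_unit \<alpha> \<and> (\<forall>v\<in>set vs. symmetry v) \<and> u = \<alpha> *\<^sub>C prod_list vs"
    using complex_unit_cnj by blast
next
  assume "\<exists>\<alpha> vs. complex_unit \<alpha> \<and> (\<forall>v\<in>set vs. symmetry v) \<and> u = \<alpha> *\<^sub>C prod_list vs"
  then obtain \<alpha> vs where \<alpha>: "complex_unit \<alpha>" and vs: "\<forall>v\<in>set vs. symmetry v"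
    and u: "u = \<alpha> *\<^sub>C prod_list vs" by blast
  have "transitive_hull le_h (cnj \<alpha> *\<^sub>C u) 1"
    using transitive_hull_le_h_prod_list(1)[OF vs] \<alpha> u by simp
  moreover have "transitive_hull le_h (\<alpha> *\<^sub>C 1) u"
    using transitive_hull_le_h_scaleC[OF \<alpha> transitive_hull_le_h_prod_list(2)[OF vs]] u by simp
  ultimately show "equiv_of (transitive_hull le_hc) u 1"
    unfolding equiv_of_def transitive_hull_le_hc_iff[OF assms]
      transitive_hull_le_hc_iff[OF tripotent_1] using \<alpha> complex_unit_cnj by blast
qed

text \<open>Unitaries are closed under products, so a single one absorbs the factors of all steps.
  Conversely, the chain \<open>1\<close>, \<open>v\<close>, \<open>p * v\<close> has two steps,
  because \<open>v\<close> and \<open>p\<close> are normal.\<close>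

lemma transitive_hull_le_n_1_iff:
  "transitive_hull le_n u 1 \<longleftrightarrow> (\<exists>p v. projection p \<and> unitary v \<and> u = p * v)"
proof
  assume "transitive_hull le_n u 1"
  then show "\<exists>p v. projection p \<and> unitary v \<and> u = p * v"
  proof (induction rule: transitive_hull_induct)
    case refl
    show ?case by (intro exI[of _ 1]) (simp add: projection_1 unitary_1)
  next
    case (step e u)
    then obtain p s where p: "projection p" and s: "unitary s" and e: "e = p * s" by blast
    have t: "tripotent (u * s\<^sup>\<star>)"
      by (rule tripotent_mult_unitary[OF unitary_star[OF s] step.hyps(2)])
    have "le_n (u * s\<^sup>\<star>) (p * s * s\<^sup>\<star>)"
      using le_n_mult_unitary[OF unitary_star[OF s] step.hyps(3)] by (simp add: e)
    then have "normal_element (u * s\<^sup>\<star>)"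
      using le_n_projection_imp_normal[OF p t] by (simp only: unitary_cancel[OF s])
    then obtain q v where q: "projection q" "unitary v" "u * s\<^sup>\<star> = q * v"
      using tripotent_normal_factor[OF t] by blast
    have "u = u * s\<^sup>\<star> * s" by (simp only: unitary_cancel[OF s])
    then have "u = q * (v * s)" by (simp only: q mult.assoc)
    with q s show ?case by (blast intro: unitary_mult)
  qed
next
  assume "\<exists>p v. projection p \<and> unitary v \<and> u = p * v"
  then obtain p v where p: "projection p" and v: "unitary v" and u: "u = p * v" by blast
  note tp = projection_imp_tripotent[OF p] and tv = unitary_imp_tripotent[OF v]
  have "le_n p 1" using le_n_1_iff[OF tp] p by (simp add: normal_element_def projectionD)
  then have "le_n u v" using le_n_mult_unitary[OF v] u by fastforce
  moreover have "le_n v 1" using le_n_1_iff[OF tv] v by (simp add: normal_element_def unitaryD)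
  moreover have "tripotent u" using tripotent_mult_unitary[OF v tp] u by simp
  ultimately show "transitive_hull le_n u 1"
    using tv tripotent_1 by (blast intro: transitive_hull_step transitive_hull_single)
qed


section \<open>Relations up to a scalar\<close>

lemma le_c_1_iff:
  "le_c u 1 \<longleftrightarrow> (\<exists>\<alpha> p. complex_unit \<alpha> \<and> projection p \<and> u = \<alpha> *\<^sub>C p)"
  unfolding le_c_def trip_le_1_iff by (metis complex_unit_cnj scaleC_unit_cancel)

lemma complex_unit_sgn: "c \<noteq> 0 \<Longrightarrow> complex_unit (sgn c)"
  by (simp add: complex_unit_def norm_sgn)

lemma cnj_sgn_mult: "cnj (sgn c) * c = complex_of_real (cmod c)"
proof (cases "c = 0")
  case False
  then have "c = complex_of_real (cmod c) * sgn c"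
    by (simp add: sgn_div_norm scaleR_conv_of_real)
  then have "cnj (sgn c) * c = complex_of_real (cmod c) * (sgn c * cnj (sgn c))"
    by (metis mult.assoc mult.commute)
  then show ?thesis by (simp only: complex_unit_mult_cnj[OF complex_unit_sgn[OF False]] mult_1_right)
qed simp

text \<open>Removing the phase \<open>sgn c\<close> leaves the real multiple \<open>cmod c\<close>
  of \<open>a\<close>. The case of scalar 0 is separate, because \<open>sgn 0\<close> is not a
  complex unit.\<close>

lemma le_hc_1I:
  assumes "selfadjoint a" "u = c *\<^sub>C a" shows "le_hc u 1"
proof (cases "c = 0")
  case True
  with assms(2) have "u = 0" by simp
  then show ?thesis
    by (auto simp: le_hc_def le_h_iff intro!: exI[of _ 1] complex_unit_1)
next
  case False
  have "selfadjoint (cnj (sgn c) *\<^sub>C u)"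
    using assms by (simp only: scaleC_scaleC cnj_sgn_mult selfadjoint_def star_scaleC
        complex_cnj_complex_of_real)
  then show ?thesis
    using complex_unit_cnj[OF complex_unit_sgn[OF False]] by (auto simp: le_hc_def le_h_1_iff)
qed

lemma le_hc_1_iff: "le_hc u 1 \<longleftrightarrow> (\<exists>c a. selfadjoint a \<and> u = c *\<^sub>C a)"
proof
  assume "le_hc u 1"
  then show "\<exists>c a. selfadjoint a \<and> u = c *\<^sub>C a"
    unfolding le_hc_def le_h_1_iff by (metis scaleC_unit_cancel(1))
qed (blast intro: le_hc_1I)

lemma equiv_le_h_1_iff: "equiv_of le_h u 1 \<longleftrightarrow> symmetry u"
  by (auto simp: equiv_of_def symmetry_def selfadjoint_def le_h_iff power2_eq_square)

text \<open>The scalar has to be nonzero: \<open>0\<close> is a tripotent multiple of any symmetry,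
  but \<open>le_hc 1 0\<close> forces \<open>1 = 0\<close>.\<close>

lemma equiv_le_hc_1_iff:
  assumes "tripotent u"
  shows "equiv_of le_hc u 1 \<longleftrightarrow> (\<exists>c v. c \<noteq> 0 \<and> symmetry v \<and> u = c *\<^sub>C v)"
proof
  assume "equiv_of le_hc u 1"
  then obtain \<alpha> \<beta> where \<alpha>: "complex_unit \<alpha>" "selfadjoint (\<alpha> *\<^sub>C u)"
    and \<beta>: "complex_unit \<beta>" "le_h (\<beta> *\<^sub>C 1) u"
    by (auto simp: equiv_of_def le_hc_def le_h_1_iff)
  define w where "w = \<alpha> *\<^sub>C u"
  \<comment> \<open>Since \<open>le_h (\<beta> *\<^sub>C 1) u\<close> will give \<open>u * u\<close>
    as the square of \<beta> times \<open>1\<close>, this is the scalar of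
    \<open>w * w\<close>.\<close>
  define \<gamma> where "\<gamma> = \<alpha> * \<alpha> * \<beta> * \<beta>"
  have sa: "w\<^sup>\<star> = w" using \<alpha> by (simp add: w_def selfadjoint_def)
  have "\<beta> *\<^sub>C 1 = cnj \<beta> *\<^sub>C (u * u)" using \<beta>(2) by (simp add: le_h_iff)
  then have "\<beta> *\<^sub>C \<beta> *\<^sub>C 1 = u * u" using \<beta>(1) by simp
  then have ww: "w * w = \<gamma> *\<^sub>C 1"
    by (simp add: w_def \<gamma>_def scaleC_scaleC mult.assoc flip: \<open>\<beta> *\<^sub>C \<beta> *\<^sub>C 1 = u * u\<close>)
  \<comment> \<open>A selfadjoint tripotent has an idempotent square, and an idempotent unit
    multiple of \<open>1\<close> equals \<open>1\<close>.\<close>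
  have "w * w * w = w"
    using tripotent_scaleC[OF \<alpha>(1) assms] sa by (simp add: tripotent_iff flip: w_def)
  then have "(w * w) * (w * w) = w * w" by (simp flip: mult.assoc)
  then have "\<gamma> *\<^sub>C \<gamma> *\<^sub>C 1 = \<gamma> *\<^sub>C (1::'a)" by (simp add: ww)
  then have "cnj \<gamma> *\<^sub>C \<gamma> *\<^sub>C \<gamma> *\<^sub>C 1 = cnj \<gamma> *\<^sub>C \<gamma> *\<^sub>C (1::'a)" by (rule arg_cong)
  moreover have "complex_unit \<gamma>" using \<alpha>(1) \<beta>(1) by (simp add: \<gamma>_def complex_unit_mult)
  ultimately have "\<gamma> *\<^sub>C (1::'a) = 1" by (simp only: scaleC_unit_cancel)
  with ww sa have "symmetry w" by (simp add: symmetryI)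
  moreover have "u = cnj \<alpha> *\<^sub>C w" using \<alpha>(1) by (simp add: w_def)
  moreover have "cnj \<alpha> \<noteq> 0" using \<alpha>(1) by (auto simp: complex_unit_def)
  ultimately show "\<exists>c v. c \<noteq> 0 \<and> symmetry v \<and> u = c *\<^sub>C v" by blast
next
  assume "\<exists>c v. c \<noteq> 0 \<and> symmetry v \<and> u = c *\<^sub>C v"
  then obtain c v where c: "c \<noteq> 0" and v: "symmetry v" and u: "u = c *\<^sub>C v" by blast
  \<comment> \<open>This is tripotency of \<open>u\<close>; cancelling \<open>v\<close> and one
    factor \<open>c\<close> leaves \<open>(c * cnj c) *\<^sub>C 1 = 1\<close>.\<close>
  have "(c * cnj c * c) *\<^sub>C v = c *\<^sub>C v"
    using assms by (simp add: tripotent_iff u symmetryD[OF v] scaleC_scaleC mult_ac)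
  then have "(c * cnj c * c) *\<^sub>C v * v = c *\<^sub>C v * v" by simp
  then have "(c * cnj c * c) *\<^sub>C (1::'a) = c *\<^sub>C 1" by (simp add: symmetryD[OF v])
  then have "inverse c *\<^sub>C (c * cnj c * c) *\<^sub>C (1::'a) = inverse c *\<^sub>C c *\<^sub>C 1" by simp
  then have cc: "(c * cnj c) *\<^sub>C (1::'a) = 1" using c by (simp add: field_simps)
  \<comment> \<open>In the zero algebra this does not force \<open>c\<close> to be a complex unit.\<close>
  have "cnj (sgn c) * (c * c) = sgn c * (c * cnj c)"
    by (simp add: sgn_div_norm scaleR_conv_of_real)
  then have "(cnj (sgn c) * (c * c)) *\<^sub>C (1::'a) = sgn c *\<^sub>C 1"
    using cc scaleC_scaleC[of "sgn c" "c * cnj c" "1::'a"] by (simp only:)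
  then have "le_h (sgn c *\<^sub>C 1) u"
    by (simp add: le_h_iff u symmetryD[OF v] scaleC_scaleC mult_ac)
  then have "le_hc 1 u" using complex_unit_sgn[OF c] by (auto simp: le_hc_def)
  moreover have "le_hc u 1" using le_hc_1I[OF _ u] v by (simp add: symmetry_def)
  ultimately show "equiv_of le_hc u 1" by (simp add: equiv_of_def)
qed

theorem proposition4p2:
  fixes u :: "'a::unital_cstar_algebra"
  assumes "tripotent u"
  shows
    "(u \<le>\<^sub>T 1 \<longleftrightarrow> projection u) \<and>
     (le_r u 1 \<longleftrightarrow> projection u \<or> projection (- u)) \<and>
     (le_c u 1 \<longleftrightarrow> (\<exists>\<alpha> p. complex_unit \<alpha> \<and> projection p \<and> u = \<alpha> *\<^sub>C p)) \<and>
     (le_h u 1 \<longleftrightarrow> selfadjoint u) \<and>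
     (equiv_of le_h u 1 \<longleftrightarrow> symmetry u) \<and>
     (equiv_of (transitive_hull le_h) u 1 \<longleftrightarrow>
        (\<exists>vs. (\<forall>v\<in>set vs. symmetry v) \<and> u = prod_list vs)) \<and>
     (transitive_hull le_h u 1 \<longleftrightarrow>
        (\<exists>p vs. projection p \<and> (\<forall>v\<in>set vs. symmetry v) \<and> u = p * prod_list vs)) \<and>
     (le_hc u 1 \<longleftrightarrow> (\<exists>c a. selfadjoint a \<and> u = c *\<^sub>C a)) \<and>
     (equiv_of le_hc u 1 \<longleftrightarrow> (\<exists>c v. c \<noteq> 0 \<and> symmetry v \<and> u = c *\<^sub>C v)) \<and>
     (equiv_of (transitive_hull le_hc) u 1 \<longleftrightarrow>
        (\<exists>\<alpha> vs. complex_unit \<alpha> \<and> (\<forall>v\<in>set vs. symmetry v) \<and> u = \<alpha> *\<^sub>C prod_list vs)) \<and>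
     (transitive_hull le_hc u 1 \<longleftrightarrow>
        (\<exists>\<alpha> p vs. complex_unit \<alpha> \<and> projection p \<and> (\<forall>v\<in>set vs. symmetry v) \<and>
                  u = \<alpha> *\<^sub>C (p * prod_list vs))) \<and>
     (le_n u 1 \<longleftrightarrow> normal_element u) \<and>
     (transitive_hull le_n u 1 \<longleftrightarrow> (\<exists>p v. projection p \<and> unitary v \<and> u = p * v)) \<and>
     (equiv_of le_2 u 1 \<longleftrightarrow> unitary u)"
  unfolding le_r_def
  by (intro conjI trip_le_1_iff le_c_1_iff le_h_1_iff equiv_le_h_1_iff equiv_hull_le_h_1_iff
      transitive_hull_le_h_1_iff le_hc_1_iff equiv_le_hc_1_iff[OF assms]
      equiv_hull_le_hc_1_iff[OF assms] transitive_hull_le_hc_1_iff[OF assms] le_n_1_iff[OF assms]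
      transitive_hull_le_n_1_iff equiv_le_2_1_iff[OF assms])
    (simp add: trip_le_1_iff)

end
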